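(* Let $G=(V,E)$ be an infinite connected graph (directed or undirected) of bounded degree, let $\nu$ be a probability distribution on $\mathbf{N}^*=\{1,2,\dots\}$, and let $R$ be a random variable distributed according to $\nu$. For all $n\ge 1$, let $\varphi(n):=\Delta\sum_{r=1}^{n}c_r\,c_r^\top$. If $\mathbf{E}[\varphi(R)]<\infty$, then $$p_c(G,\nu)\ \ge\ \frac{1}{\mathbf{E}[\varphi(R)]}\ >\ 0 .$$
   Context: Graphs. $E\subset V\times V$; $G$ is undirected iff $(x,y)\in E\Leftrightarrow(y,x)\in E$ for all $x,y \in V$. For directed graphs, "connected" always means weakly connected, i.e. the underlying undirected graph is connected; connected components of subsets of $V$ are also taken in the underlying undirected graph. $G$ is infinite, connected and locally finite. For $x,y\in V$, $d(x,y)\in\mathbf{N}\cup\{+\infty\}$ is the minimal number of (oriented) edges of a path from $x$ to $y$ ($+\infty$ if there is none). For $x\in V$ and $r\in\mathbf{N}=\{0,1,2,\dots\}$, $B_r(x)=\{y\in V: d(x,y)<r\}$ and $B_r^\top(x)=\{y\in V: d(y,x)<r\}$. For $x\in V$, $d(x)$ is the number of vertices $y\neq x$ such that $(x,y)\in E$ or $(y,x)\in E$ (number of neighbours without regard to orientation), and $\Delta=\sup_{x\in V}d(x)$. $G$ is of bounded degree if $\Delta<\infty$. Set $c_r=\sup_{x\in V}|B_r(x)|$ and $c_r^\top=\sup_{x\in V}|B_r^\top(x)|$ (finite when $\Delta<\infty$). Boolean percolation model. Let $p\in[0,1]$. Let $(R_x)_{x\in V}$ be i.i.d. with law $\nu$,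 and let $(\sigma_x)_{x\in V}$ be i.i.d. Bernoulli of parameter $p$, independent of $(R_x)_{x\in V}$. The wet set is $W=\bigcup_{x\in V,\ \sigma_x=1}B_{R_x}(x)$. For $x\in V$, $W_x$ is the connected component of $x$ in $W$ (i.e. in the subgraph induced by $W$), with $W_x=\emptyset$ if $x\notin W$. The critical parameter is $$p_c(G,\nu)=\inf\Big\{p\in[0,1]:\ \mathbf{P}\Big(\bigcup_{x\in V}\{|W_x|=\infty\}\Big)=1\Big\}.$$ *)

theory Defs
  imports "HOL-Probability.Probability"
begin

text \<open>A graph is a vertex set \<open>V\<close> with an edge relation \<open>E \<subseteq> V \<times> V\<close>; loops are allowed, and
  undirected graphs are those with \<open>sym E\<close>. Connectedness is always meant in the underlying
  undirected graph.\<close>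

definition weakly_connected :: "'v set \<Rightarrow> 'v rel \<Rightarrow> bool" where
  "weakly_connected V E \<longleftrightarrow> (\<forall>x\<in>V. \<forall>y\<in>V. (x, y) \<in> (E \<union> E\<inverse>)\<^sup>*)"

text \<open>Oriented distance; \<open>\<infinity>\<close> (the infimum of the empty set) if there is no path.\<close>

definition gdist :: "'v rel \<Rightarrow> 'v \<Rightarrow> 'v \<Rightarrow> enat" where
  "gdist E x y = (INF n\<in>{n. (x, y) \<in> E ^^ n}. enat n)"

definition out_ball :: "'v set \<Rightarrow> 'v rel \<Rightarrow> nat \<Rightarrow> 'v \<Rightarrow> 'v set" where
  "out_ball V E r x = {y \<in> V. gdist E x y < enat r}"

definition in_ball :: "'v set \<Rightarrow> 'v rel \<Rightarrow> nat \<Rightarrow> 'v \<Rightarrow> 'v set" where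
  "in_ball V E r x = {y \<in> V. gdist E y x < enat r}"

text \<open>The cardinality as an extended number, so that infinite sets have cardinality \<open>\<infinity>\<close>
  (unlike with \<open>card\<close>) and the suprema below are unproblematic.\<close>

definition ecard :: "'a set \<Rightarrow> ennreal" where
  "ecard A = (if finite A then of_nat (card A) else \<infinity>)"

definition vdegree :: "'v set \<Rightarrow> 'v rel \<Rightarrow> 'v \<Rightarrow> ennreal" where
  "vdegree V E x = ecard {y \<in> V. y \<noteq> x \<and> ((x, y) \<in> E \<or> (y, x) \<in> E)}"

definition max_degree :: "'v set \<Rightarrow> 'v rel \<Rightarrow> ennreal" where
  "max_degree V E = (SUP x\<in>V. vdegree V E x)"

definition max_out_ball :: "'v set \<Rightarrow> 'v rel \<Rightarrow> nat \<Rightarrow> ennreal" where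
  "max_out_ball V E r = (SUP x\<in>V. ecard (out_ball V E r x))"

definition max_in_ball :: "'v set \<Rightarrow> 'v rel \<Rightarrow> nat \<Rightarrow> ennreal" where
  "max_in_ball V E r = (SUP x\<in>V. ecard (in_ball V E r x))"

definition phi :: "'v set \<Rightarrow> 'v rel \<Rightarrow> nat \<Rightarrow> ennreal" where
  "phi V E n = max_degree V E * (\<Sum>r=1..n. max_out_ball V E r * max_in_ball V E r)"

text \<open>Boolean percolation is realised on the canonical product space: a configuration \<open>(R, \<sigma>)\<close>
  consists of an i.i.d. family of radii with law \<open>\<nu>\<close> and an independent i.i.d. family of
  Bernoulli marks of parameter \<open>p\<close>.\<close>

definition boolean_percolation ::
    "'v set \<Rightarrow> nat pmf \<Rightarrow> real \<Rightarrow> (('v \<Rightarrow> nat) \<times> ('v \<Rightarrow> bool)) measure" where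
  "boolean_percolation V \<nu> p =
     (\<Pi>\<^sub>M x\<in>V. measure_pmf \<nu>) \<Otimes>\<^sub>M (\<Pi>\<^sub>M x\<in>V. measure_pmf (bernoulli_pmf p))"

definition wet_set :: "'v set \<Rightarrow> 'v rel \<Rightarrow> ('v \<Rightarrow> nat) \<times> ('v \<Rightarrow> bool) \<Rightarrow> 'v set" where
  "wet_set V E = (\<lambda>(R, \<sigma>). \<Union>x\<in>{x \<in> V. \<sigma> x}. out_ball V E (R x) x)"

definition component_in :: "'v rel \<Rightarrow> 'v set \<Rightarrow> 'v \<Rightarrow> 'v set" where
  "component_in E A x = {y \<in> A. x \<in> A \<and> (x, y) \<in> ((E \<union> E\<inverse>) \<inter> A \<times> A)\<^sup>*}"

text \<open>The event below is measurable as soon as \<open>V\<close> is countable, which holds for every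
  connected, locally finite graph.\<close>

definition percolation_prob :: "'v set \<Rightarrow> 'v rel \<Rightarrow> nat pmf \<Rightarrow> real \<Rightarrow> real" where
  "percolation_prob V E \<nu> p =
     measure (boolean_percolation V \<nu> p)
       {\<omega> \<in> space (boolean_percolation V \<nu> p).
          \<exists>x\<in>V. infinite (component_in E (wet_set V E \<omega>) x)}"

text \<open>For infinite connected \<open>V\<close> and \<open>\<nu>\<close> supported on the positive integers, \<open>p = 1\<close> belongs to
  the following set (\<open>W = V\<close> almost surely), so the infimum is over a nonempty set.\<close>

definition critical_param :: "'v set \<Rightarrow> 'v rel \<Rightarrow> nat pmf \<Rightarrow> real" where
  "critical_param V E \<nu> = Inf {p \<in> {0..1}. percolation_prob V E \<nu> p = 1}"

end

theory Submission
  imports Defs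
begin

text \<open>Let \<open>m\<close> be the expectation of \<^const>\<open>phi\<close> under \<open>\<nu>\<close>. For \<open>p * m < 1\<close> percolation has probability \<open>0\<close>,
  by a first-moment bound on chains of balls.

  Suppose that \<open>v\<close> lies in an infinite wet component. Some open ball contains \<open>v\<close>; it is finite,
  and after its removal one of the finitely many vertices next to it lies in an infinite component
  of the remaining wet vertices. That vertex is covered by a ball with a new centre, because it is
  outside the first ball. Repeating this gives, for every \<open>n\<close>, a chain of \<open>n\<close> open balls with
  distinct centres, the first of which contains \<open>v\<close>, each one containing a neighbour of a vertex of
  its predecessor (\<open>infinite_component_imp_cover_chain\<close>).

  As the centres are distinct, the radii and marks along a chain are independent, so it suffices to
  bound one step: the expected number of triples of an open centre \<open>y\<close> whose ball contains a given
  vertex, a vertex \<open>u\<close> of that ball, and a neighbour of \<open>u\<close>. If \<open>R y = r\<close>, then \<open>y\<close> is in the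
  incoming ball of radius \<open>r\<close> around the given vertex, and \<open>u\<close> in the outgoing ball of radius \<open>r\<close>
  around \<open>y\<close>, so there are at most \<open>\<Delta> * c r * c\<^sup>\<top> r\<close> such triples for each \<open>r\<close>; this is only
  the last term of the sum \<open>phi r\<close>. The expectation is thus at most \<open>p * m\<close>, and a chain of length
  \<open>n\<close> exists with probability at most \<open>(p * m) ^ n\<close> (\<open>emeasure_cover_chain_le\<close>), which tends to \<open>0\<close>.

  Hence every \<open>p\<close> for which percolation is almost sure satisfies \<open>1 \<le> p * m\<close>. For \<open>p = 1\<close> every vertex
  is almost surely wet and percolation occurs (\<open>percolation_prob_one\<close>), so the infimum defining the
  critical parameter is over a nonempty set and \<open>m\<close> is positive.\<close>

section \<open>Cardinalities, balls and neighbours\<close>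

lemma ecard_eq_emeasure: "ecard A = emeasure (count_space UNIV) A"
  by (simp add: ecard_def emeasure_count_space)

lemma ecard_less_top_iff: "ecard A < \<top> \<longleftrightarrow> finite A"
  by (simp add: ecard_def of_nat_less_top)

lemma ecard_Sigma_le:
  assumes "ecard A \<le> a" and "\<And>x. x \<in> A \<Longrightarrow> ecard (B x) \<le> b"
  shows "ecard (Sigma A B) \<le> b * a"
proof -
  have "ecard (Sigma A B) = (\<integral>\<^sup>+ z. indicator (Sigma A B) z \<partial>count_space UNIV)"
    by (simp add: ecard_eq_emeasure)
  also have "\<dots> = (\<integral>\<^sup>+ x. \<integral>\<^sup>+ y. indicator (Sigma A B) (x, y) \<partial>count_space UNIV \<partial>count_space UNIV)"
    by (rule nn_integral_fst_count_space[symmetric])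
  also have "\<dots> = (\<integral>\<^sup>+ x. ecard (B x) * indicator A x \<partial>count_space UNIV)"
  proof (rule nn_integral_cong)
    fix x
    have "(\<integral>\<^sup>+ y. indicator (Sigma A B) (x, y) \<partial>count_space UNIV) =
        (\<integral>\<^sup>+ y. indicator A x * indicator (B x) y \<partial>count_space UNIV)"
      by (intro nn_integral_cong) (simp add: indicator_def)
    also have "\<dots> = indicator A x * (\<integral>\<^sup>+ y. indicator (B x) y \<partial>count_space UNIV)"
      by (rule nn_integral_cmult) simp
    finally show "(\<integral>\<^sup>+ y. indicator (Sigma A B) (x, y) \<partial>count_space UNIV) = ecard (B x) * indicator A x"
      by (simp add: ecard_eq_emeasure mult.commute)
  qed
  also have "\<dots> \<le> (\<integral>\<^sup>+ x. b * indicator A x \<partial>count_space UNIV)"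
    using assms(2) by (intro nn_integral_mono) (auto simp: indicator_def)
  also have "\<dots> = b * ecard A"
    by (simp add: nn_integral_cmult_indicator ecard_eq_emeasure)
  also have "\<dots> \<le> b * a"
    using assms(1) by (rule mult_left_mono) simp
  finally show ?thesis .
qed

lemma mem_out_ball_iff: "y \<in> out_ball V E r x \<longleftrightarrow> y \<in> V \<and> (\<exists>n<r. (x, y) \<in> E ^^ n)"
  by (auto simp: out_ball_def gdist_def INF_less_iff)

lemma mem_in_ball_iff: "y \<in> in_ball V E r x \<longleftrightarrow> y \<in> V \<and> (\<exists>n<r. (y, x) \<in> E ^^ n)"
  by (auto simp: in_ball_def gdist_def INF_less_iff)

text \<open>The neighbours of a vertex, regardless of orientation; these are the vertices counted by
  \<^const>\<open>vdegree\<close>, so a vertex is not a neighbour of itself.\<close>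

definition neighbours :: "'v set \<Rightarrow> 'v rel \<Rightarrow> 'v \<Rightarrow> 'v set" where
  "neighbours V E x = {y \<in> V. y \<noteq> x \<and> ((x, y) \<in> E \<or> (y, x) \<in> E)}"

lemma ecard_neighbours_le: "x \<in> V \<Longrightarrow> ecard (neighbours V E x) \<le> max_degree V E"
  unfolding max_degree_def by (rule SUP_upper2[of x]) (auto simp: vdegree_def neighbours_def)

lemma finite_neighbours:
  assumes "E \<subseteq> V \<times> V" and "max_degree V E < \<infinity>"
  shows "finite (neighbours V E x)"
proof (cases "x \<in> V")
  case True
  then have "ecard (neighbours V E x) < \<infinity>"
    by (rule le_less_trans[OF ecard_neighbours_le assms(2)])
  then show ?thesis
    by (simp add: ecard_less_top_iff)
next
  case False
  then have "neighbours V E x = {}"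
    using assms(1) by (auto simp: neighbours_def)
  then show ?thesis by simp
qed

lemma finite_Image_relpow:
  fixes r :: "'a rel"
  assumes "\<And>x. finite (r `` {x})"
  shows "finite ((r ^^ n) `` {x})"
proof (induction n)
  case (Suc n)
  have "(r ^^ Suc n) `` {x} = (\<Union>y\<in>(r ^^ n) `` {x}. r `` {y})"
    by auto
  then show ?case
    using Suc assms by simp
qed simp

lemma finite_Image_sym_edges:
  assumes "E \<subseteq> V \<times> V" and "max_degree V E < \<infinity>"
  shows "finite ((E \<union> E\<inverse>) `` {x})"
proof (rule finite_subset)
  show "(E \<union> E\<inverse>) `` {x} \<subseteq> insert x (neighbours V E x)"
    using assms(1) by (auto simp: neighbours_def)
qed (simp add: finite_neighbours[OF assms])

lemma finite_out_ball:
  assumes "E \<subseteq> V \<times> V" and "max_degree V E < \<infinity>"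
  shows "finite (out_ball V E r x)"
proof (rule finite_subset)
  show "out_ball V E r x \<subseteq> (\<Union>n<r. (E ^^ n) `` {x})"
    by (auto simp: mem_out_ball_iff)
  have "finite (E `` {y})" for y
    by (rule finite_subset[OF _ finite_Image_sym_edges[OF assms, of y]]) auto
  then show "finite (\<Union>n<r. (E ^^ n) `` {x})"
    by (intro finite_UN_I finite_lessThan finite_Image_relpow)
qed

lemma countable_vertices:
  assumes "E \<subseteq> V \<times> V" and "weakly_connected V E" and "max_degree V E < \<infinity>"
  shows "countable V"
proof (cases "V = {}")
  case False
  then obtain x where "x \<in> V" by blast
  then have "V \<subseteq> (\<Union>n. ((E \<union> E\<inverse>) ^^ n) `` {x})"
    using assms(2) by (auto simp: weakly_connected_def rtrancl_power)
  moreover have "countable (\<Union>n. ((E \<union> E\<inverse>) ^^ n) `` {x})"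
    by (intro countable_UN[OF countableI_type] countable_finite finite_Image_relpow
        finite_Image_sym_edges[OF assms(1,3)])
  ultimately show ?thesis
    by (rule countable_subset)
qed simp

section \<open>Chains of distinct open balls\<close>

text \<open>\<open>cover_chain V E n S v\<close> is the event that there are \<open>n\<close> distinct open centres outside \<open>S\<close>
  such that the ball of the first one contains \<open>v\<close> and every ball contains a neighbour of some
  vertex of the preceding ball. Distinctness is encoded by adding each centre to \<open>S\<close>.\<close>

primrec cover_chain ::
    "'v set \<Rightarrow> 'v rel \<Rightarrow> nat \<Rightarrow> 'v set \<Rightarrow> 'v \<Rightarrow> ('v \<Rightarrow> nat) \<times> ('v \<Rightarrow> bool) \<Rightarrow> bool" where
  "cover_chain V E 0 S v \<omega> \<longleftrightarrow> True"
| "cover_chain V E (Suc n) S v \<omega> \<longleftrightarrow>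
     (\<exists>y\<in>V - S. snd \<omega> y \<and> v \<in> out_ball V E (fst \<omega> y) y \<and>
        (\<exists>u\<in>out_ball V E (fst \<omega> y) y. \<exists>w\<in>neighbours V E u. cover_chain V E n (insert y S) w \<omega>))"

text \<open>Chains that avoid the centre \<open>z\<close> do not depend on the radius and the mark at \<open>z\<close>.\<close>

lemma cover_chain_upd:
  assumes "z \<in> S"
  shows "cover_chain V E n S v (R(z := r), \<sigma>(z := b)) \<longleftrightarrow> cover_chain V E n S v (R, \<sigma>)"
  using assms
proof (induction n arbitrary: S v)
  case (Suc n)
  have "cover_chain V E n (insert y S) w (R(z := r), \<sigma>(z := b)) \<longleftrightarrow>
        cover_chain V E n (insert y S) w (R, \<sigma>)" for y w
    using Suc by blast
  moreover have "y \<noteq> z" if "y \<in> V - S" for y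
    using that Suc.prems by blast
  ultimately show ?case
    by (auto simp: fun_upd_def)
qed simp

text \<open>A path that starts in \<open>B\<close> and does not end there stays outside \<open>B\<close> after its last exit, from
  some \<open>u\<close> to a neighbour \<open>w\<close>.\<close>

lemma component_subset_ball_Un_components:
  assumes "A \<subseteq> V" and "v \<in> B"
  shows "component_in E A v \<subseteq> B \<union> (\<Union>u\<in>B. \<Union>w\<in>neighbours V E u. component_in E (A - B) w)"
proof
  fix z assume "z \<in> component_in E A v"
  then have "(v, z) \<in> ((E \<union> E\<inverse>) \<inter> A \<times> A)\<^sup>*"
    by (simp add: component_in_def)
  then show "z \<in> B \<union> (\<Union>u\<in>B. \<Union>w\<in>neighbours V E u. component_in E (A - B) w)"
  proof (induction rule: rtrancl_induct)
    case base
    show ?case using assms(2) by simp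
  next
    case (step z z')
    show ?case
    proof (cases "z' \<in> B")
      case False
      then have z': "z' \<in> A - B" using step.hyps by blast
      show ?thesis
      proof (cases "z \<in> B")
        case True
        then have "z' \<in> neighbours V E z"
          using False step.hyps assms(1) by (auto simp: neighbours_def)
        moreover have "z' \<in> component_in E (A - B) z'"
          using z' by (simp add: component_in_def)
        ultimately show ?thesis using True by blast
      next
        case z: False
        then obtain u w where uw: "u \<in> B" "w \<in> neighbours V E u" "z \<in> component_in E (A - B) w"
          using step.IH by blast
        have "(z, z') \<in> (E \<union> E\<inverse>) \<inter> (A - B) \<times> (A - B)"
          using step.hyps z z' by blast
        then have "z' \<in> component_in E (A - B) w"
          using uw(3) z' by (auto simp: component_in_def intro: rtrancl_into_rtrancl)
        then show ?thesis using uw by blast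
      qed
    qed simp
  qed
qed

text \<open>When a finite ball that contains \<open>v\<close> is removed, one of the finitely many components that
  start next to the ball is still infinite. The set \<open>A\<close> is what remains of the wet set after the
  balls centred in \<open>S\<close> have been removed, so that every ball that covers a vertex of \<open>A\<close> has its centre outside \<open>S\<close>.\<close>

lemma infinite_component_imp_cover_chain:
  assumes "E \<subseteq> V \<times> V" and "max_degree V E < \<infinity>"
    and "A \<subseteq> wet_set V E \<omega>" and "\<And>s. s \<in> S \<Longrightarrow> A \<inter> out_ball V E (fst \<omega> s) s = {}"
    and "infinite (component_in E A v)"
  shows "cover_chain V E n S v \<omega>"
  using assms(3-)
proof (induction n arbitrary: S v A)
  case (Suc n)
  have "v \<in> A"
    using Suc.prems(3) by (auto simp: component_in_def intro: ccontr)
  then obtain y where y: "y \<in> V" "snd \<omega> y" "v \<in> out_ball V E (fst \<omega> y) y"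
    using Suc.prems(1) by (auto simp: wet_set_def split: prod.splits)
  define B where "B = out_ball V E (fst \<omega> y) y"
  have "y \<notin> S"
    using Suc.prems(2) \<open>v \<in> A\<close> y(3) by blast
  have "A \<subseteq> V"
    using Suc.prems(1) by (auto simp: wet_set_def out_ball_def split: prod.splits)
  then have "infinite (B \<union> (\<Union>u\<in>B. \<Union>w\<in>neighbours V E u. component_in E (A - B) w))"
    using component_subset_ball_Un_components[of A V v B E] Suc.prems(3) y(3)
    unfolding B_def by (meson finite_subset)
  moreover have "finite B"
    unfolding B_def by (rule finite_out_ball[OF assms(1,2)])
  ultimately obtain u w where uw: "u \<in> B" "w \<in> neighbours V E u"
      "infinite (component_in E (A - B) w)"
    using finite_neighbours[OF assms(1,2)] by blast
  have "cover_chain V E n (insert y S) w \<omega>"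
    by (rule Suc.IH[OF _ _ uw(3)]) (use Suc.prems in \<open>auto simp: B_def\<close>)
  then show ?case
    using y \<open>y \<notin> S\<close> uw unfolding B_def by auto
qed simp

section \<open>Measurability and independence\<close>

text \<open>The \<open>k\<close>-th coordinate of a product of probability spaces is independent of every function
  of the other coordinates.\<close>

lemma nn_integral_PiM_component_mult:
  assumes M: "\<And>i. i \<in> I \<Longrightarrow> prob_space (M i)" and "k \<in> I"
    and f: "f \<in> borel_measurable (PiM I M)" and g: "g \<in> borel_measurable (M k)"
    and f_upd: "\<And>X x. f (X(k := x)) = f X"
  shows "(\<integral>\<^sup>+ \<omega>. g (\<omega> k) * f \<omega> \<partial>PiM I M) = (\<integral>\<^sup>+ x. g x \<partial>M k) * (\<integral>\<^sup>+ \<omega>. f \<omega> \<partial>PiM I M)"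
proof -
  define J where "J = I - {k}"
  have I: "I = insert k J" using \<open>k \<in> I\<close> by (auto simp: J_def)
  interpret k: prob_space "M k" using M \<open>k \<in> I\<close> .
  interpret J: prob_space "PiM J M" by (rule prob_space_PiM) (simp add: M J_def)
  \<comment> \<open>The product measure is invariant under resampling of the coordinate \<open>k\<close>, which \<open>f\<close> ignores.\<close>
  have eq: "distr (M k \<Otimes>\<^sub>M PiM J M) (PiM I M) (\<lambda>(x, X). X(k := x)) = PiM I M"
    unfolding I by (rule distr_pair_PiM_eq_PiM) (use M I in auto)
  have upd [measurable]: "(\<lambda>(x, X). X(k := x)) \<in> M k \<Otimes>\<^sub>M PiM J M \<rightarrow>\<^sub>M PiM I M"
    unfolding I by measurable
  note [measurable] = f g
  have [measurable]: "(\<lambda>\<omega>. \<omega> k) \<in> PiM I M \<rightarrow>\<^sub>M M k"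
    using \<open>k \<in> I\<close> by measurable
  have fJ: "(\<lambda>X. f X) \<in> borel_measurable (PiM J M)"
  proof -
    obtain x where x: "x \<in> space (M k)" using k.not_empty by blast
    have "(\<lambda>X. f ((\<lambda>(x, X). X(k := x)) (x, X))) \<in> borel_measurable (PiM J M)"
      using x by measurable
    then show ?thesis by (simp add: f_upd)
  qed
  note [measurable] = fJ
  have split: "(\<integral>\<^sup>+ \<omega>. h (\<omega> k) * f \<omega> \<partial>PiM I M) = (\<integral>\<^sup>+ x. h x \<partial>M k) * (\<integral>\<^sup>+ X. f X \<partial>PiM J M)"
    if [measurable]: "h \<in> borel_measurable (M k)" for h
  proof -
    have "(\<integral>\<^sup>+ \<omega>. h (\<omega> k) * f \<omega> \<partial>PiM I M) =
        (\<integral>\<^sup>+ \<omega>. h (\<omega> k) * f \<omega> \<partial>distr (M k \<Otimes>\<^sub>M PiM J M) (PiM I M) (\<lambda>(x, X). X(k := x)))"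
      by (simp only: eq)
    also have "\<dots> = (\<integral>\<^sup>+ z. h (fst z) * f (snd z) \<partial>(M k \<Otimes>\<^sub>M PiM J M))"
      by (subst nn_integral_distr) (auto simp: f_upd split_beta)
    also have "\<dots> = (\<integral>\<^sup>+ x. \<integral>\<^sup>+ X. h x * f X \<partial>PiM J M \<partial>M k)"
      by (subst J.nn_integral_fst[symmetric]) simp_all
    also have "\<dots> = (\<integral>\<^sup>+ x. h x \<partial>M k) * (\<integral>\<^sup>+ X. f X \<partial>PiM J M)"
      by (simp add: nn_integral_cmult nn_integral_multc)
    finally show ?thesis .
  qed
  have "(\<integral>\<^sup>+ \<omega>. f \<omega> \<partial>PiM I M) = (\<integral>\<^sup>+ X. f X \<partial>PiM J M)"
    using split[of "\<lambda>_. 1"] by (simp add: k.emeasure_space_1)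
  then show ?thesis
    using split[OF g] by simp
qed

text \<open>Likewise for the radius and the mark at \<open>y\<close>, which are independent of each other and of
  every function of the radii and marks at the other vertices.\<close>

lemma nn_integral_boolean_percolation_component_mult:
  assumes "y \<in> V" and f [measurable]: "f \<in> borel_measurable (boolean_percolation V \<nu> p)"
    and upd: "\<And>R \<sigma> r b. f (R(y := r), \<sigma>(y := b)) = f (R, \<sigma>)"
  shows "(\<integral>\<^sup>+ \<omega>. g (fst \<omega> y) * h (snd \<omega> y) * f \<omega> \<partial>boolean_percolation V \<nu> p) =
    (\<integral>\<^sup>+ r. g r \<partial>measure_pmf \<nu>) * (\<integral>\<^sup>+ b. h b \<partial>measure_pmf (bernoulli_pmf p)) *
    (\<integral>\<^sup>+ \<omega>. f \<omega> \<partial>boolean_percolation V \<nu> p)"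
proof -
  let ?A = "\<Pi>\<^sub>M x\<in>V. measure_pmf \<nu>" and ?B = "\<Pi>\<^sub>M x\<in>V. measure_pmf (bernoulli_pmf p)"
  interpret A: prob_space ?A by (rule prob_space_PiM) (rule measure_pmf.prob_space_axioms)
  interpret B: prob_space ?B by (rule prob_space_PiM) (rule measure_pmf.prob_space_axioms)
  have f' [measurable]: "f \<in> borel_measurable (?A \<Otimes>\<^sub>M ?B)"
    using f by (simp add: boolean_percolation_def)
  have [measurable]: "(\<lambda>R. g (R y)) \<in> borel_measurable ?A" "(\<lambda>\<sigma>. h (\<sigma> y)) \<in> borel_measurable ?B"
    by (rule measurable_compose[OF measurable_component_singleton[OF \<open>y \<in> V\<close>]], simp)+
  have upd1: "f (R(y := r), \<sigma>) = f (R, \<sigma>)" for R r \<sigma>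
    using upd[of R r \<sigma> "\<sigma> y"] by simp
  have upd2: "f (R, \<sigma>(y := b)) = f (R, \<sigma>)" for R b \<sigma>
    using upd[of R "R y" \<sigma> b] by simp
  have "(\<integral>\<^sup>+ \<omega>. g (fst \<omega> y) * h (snd \<omega> y) * f \<omega> \<partial>(?A \<Otimes>\<^sub>M ?B)) =
      (\<integral>\<^sup>+ R. \<integral>\<^sup>+ \<sigma>. g (R y) * h (\<sigma> y) * f (R, \<sigma>) \<partial>?B \<partial>?A)"
    by (subst B.nn_integral_fst[symmetric]) simp_all
  also have "\<dots> = (\<integral>\<^sup>+ R. g (R y) * ((\<integral>\<^sup>+ b. h b \<partial>measure_pmf (bernoulli_pmf p)) *
      (\<integral>\<^sup>+ \<sigma>. f (R, \<sigma>) \<partial>?B)) \<partial>?A)"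
  proof (rule nn_integral_cong)
    fix R assume R: "R \<in> space ?A"
    have [measurable]: "(\<lambda>\<sigma>. f (R, \<sigma>)) \<in> borel_measurable ?B"
      using R by measurable
    have "(\<integral>\<^sup>+ \<sigma>. g (R y) * h (\<sigma> y) * f (R, \<sigma>) \<partial>?B) = g (R y) * (\<integral>\<^sup>+ \<sigma>. h (\<sigma> y) * f (R, \<sigma>) \<partial>?B)"
      by (simp add: nn_integral_cmult mult.assoc)
    also have "(\<integral>\<^sup>+ \<sigma>. h (\<sigma> y) * f (R, \<sigma>) \<partial>?B) =
        (\<integral>\<^sup>+ b. h b \<partial>measure_pmf (bernoulli_pmf p)) * (\<integral>\<^sup>+ \<sigma>. f (R, \<sigma>) \<partial>?B)"
      using \<open>y \<in> V\<close>
      by (intro nn_integral_PiM_component_mult) (auto simp: upd2 measure_pmf.prob_space_axioms)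
    finally show "(\<integral>\<^sup>+ \<sigma>. g (R y) * h (\<sigma> y) * f (R, \<sigma>) \<partial>?B) =
        g (R y) * ((\<integral>\<^sup>+ b. h b \<partial>measure_pmf (bernoulli_pmf p)) * (\<integral>\<^sup>+ \<sigma>. f (R, \<sigma>) \<partial>?B))" .
  qed
  also have "\<dots> = (\<integral>\<^sup>+ r. g r \<partial>measure_pmf \<nu>) *
      (\<integral>\<^sup>+ R. (\<integral>\<^sup>+ b. h b \<partial>measure_pmf (bernoulli_pmf p)) * (\<integral>\<^sup>+ \<sigma>. f (R, \<sigma>) \<partial>?B) \<partial>?A)"
    using \<open>y \<in> V\<close>
    by (intro nn_integral_PiM_component_mult) (auto simp: upd1 measure_pmf.prob_space_axioms)
  also have "\<dots> = (\<integral>\<^sup>+ r. g r \<partial>measure_pmf \<nu>) * (\<integral>\<^sup>+ b. h b \<partial>measure_pmf (bernoulli_pmf p)) *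
      (\<integral>\<^sup>+ R. \<integral>\<^sup>+ \<sigma>. f (R, \<sigma>) \<partial>?B \<partial>?A)"
    by (subst nn_integral_cmult) (simp_all add: mult.assoc)
  also have "(\<integral>\<^sup>+ R. \<integral>\<^sup>+ \<sigma>. f (R, \<sigma>) \<partial>?B \<partial>?A) = (\<integral>\<^sup>+ \<omega>. f \<omega> \<partial>(?A \<Otimes>\<^sub>M ?B))"
    by (rule B.nn_integral_fst) simp
  finally show ?thesis
    by (simp add: boolean_percolation_def)
qed

lemma prob_space_boolean_percolation: "prob_space (boolean_percolation V \<nu> p)"
  unfolding boolean_percolation_def
  by (intro prob_space_pair prob_space_PiM measure_pmf.prob_space_axioms)

lemma measurable_radius [measurable]:
  "y \<in> V \<Longrightarrow> (\<lambda>\<omega>. fst \<omega> y) \<in> boolean_percolation V \<nu> p \<rightarrow>\<^sub>M count_space UNIV"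
  unfolding boolean_percolation_def
  by (rule measurable_compose[OF measurable_fst],
      rule measurable_compose[OF measurable_component_singleton]) simp_all

lemma measurable_mark [measurable]:
  "y \<in> V \<Longrightarrow> (\<lambda>\<omega>. snd \<omega> y) \<in> boolean_percolation V \<nu> p \<rightarrow>\<^sub>M count_space UNIV"
  unfolding boolean_percolation_def
  by (rule measurable_compose[OF measurable_snd],
      rule measurable_compose[OF measurable_component_singleton]) simp_all

lemma pred_cover_chain:
  assumes "countable V"
  shows "Measurable.pred (boolean_percolation V \<nu> p) (cover_chain V E n S v)"
proof (induction n arbitrary: S v)
  case 0
  have "cover_chain V E 0 S v = (\<lambda>_. True)"
    by (simp add: fun_eq_iff)
  then show ?case by simp
next
  case (Suc n)
  have eq: "cover_chain V E (Suc n) S v = (\<lambda>\<omega>. \<exists>y\<in>V - S. snd \<omega> y \<and> v \<in> out_ball V E (fst \<omega> y) y \<and>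
        (\<exists>u\<in>V. u \<in> out_ball V E (fst \<omega> y) y \<and>
          (\<exists>w\<in>neighbours V E u. cover_chain V E n (insert y S) w \<omega>)))"
    by (auto simp: fun_eq_iff out_ball_def)
  have c: "countable (V - S)" "countable (neighbours V E u)" for u
    using assms by (auto simp: neighbours_def)
  have ball: "Measurable.pred (boolean_percolation V \<nu> p) (\<lambda>\<omega>. u \<in> out_ball V E (fst \<omega> y) y)"
    if "y \<in> V" for y u
    by (rule measurable_compose[OF measurable_radius[OF that]]) simp
  show ?case
    unfolding eq
    by (intro measurable_pred_countable c assms pred_intros_logic Suc.IH measurable_mark ball) auto
qed

lemma pred_mem_wet_set:
  assumes "countable V"
  shows "Measurable.pred (boolean_percolation V \<nu> p) (\<lambda>\<omega>. z \<in> wet_set V E \<omega>)"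
proof -
  have "(\<lambda>\<omega>. z \<in> wet_set V E \<omega>) = (\<lambda>\<omega>. \<exists>y\<in>V. snd \<omega> y \<and> z \<in> out_ball V E (fst \<omega> y) y)"
    by (auto simp: wet_set_def fun_eq_iff split: prod.splits)
  moreover have "Measurable.pred (boolean_percolation V \<nu> p) (\<lambda>\<omega>. z \<in> out_ball V E (fst \<omega> y) y)"
    if "y \<in> V" for y
    by (rule measurable_compose[OF measurable_radius[OF that]]) simp
  ultimately show ?thesis
    by (simp, intro measurable_pred_countable pred_intros_logic assms) (auto simp: measurable_mark)
qed

lemma pred_mem_component:
  assumes "countable V"
  shows "Measurable.pred (boolean_percolation V \<nu> p)
    (\<lambda>\<omega>. z \<in> component_in E (wet_set V E \<omega>) x)"
proof -
  let ?r = "\<lambda>\<omega>. (E \<union> E\<inverse>) \<inter> wet_set V E \<omega> \<times> wet_set V E \<omega>"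
  have step: "(x, z') \<in> ?r \<omega> ^^ Suc n \<longleftrightarrow>
      (\<exists>z\<in>V. (x, z) \<in> ?r \<omega> ^^ n \<and> (z, z') \<in> E \<union> E\<inverse> \<and> z \<in> wet_set V E \<omega> \<and> z' \<in> wet_set V E \<omega>)"
    for \<omega> n z'
    by (auto simp: wet_set_def out_ball_def split: prod.splits)
  have [measurable]: "Measurable.pred (boolean_percolation V \<nu> p) (\<lambda>\<omega>. (x, z) \<in> ?r \<omega> ^^ n)" for z n
  proof (induction n arbitrary: z)
    case (Suc n)
    show ?case
      unfolding step
      by (intro measurable_pred_countable pred_intros_logic assms Suc.IH pred_mem_wet_set) simp_all
  qed simp
  show ?thesis
    unfolding component_in_def rtrancl_power mem_Collect_eq
    by (intro pred_intros_logic pred_intros_countable pred_mem_wet_set assms) simp_all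
qed

lemma sets_infinite_component:
  assumes "countable V"
  shows "{\<omega> \<in> space (boolean_percolation V \<nu> p).
    \<exists>x\<in>V. infinite (component_in E (wet_set V E \<omega>) x)} \<in> sets (boolean_percolation V \<nu> p)"
proof -
  \<comment> \<open>Since \<open>V\<close> is countable, this expresses infinity by countably many events.\<close>
  have eq: "infinite (component_in E (wet_set V E \<omega>) x) \<longleftrightarrow>
      (\<forall>F\<in>{F. finite F \<and> F \<subseteq> V}. \<exists>z\<in>V - F. z \<in> component_in E (wet_set V E \<omega>) x)" for x \<omega>
  proof -
    have sub: "component_in E (wet_set V E \<omega>) x \<subseteq> V"
      by (auto simp: component_in_def wet_set_def out_ball_def split: prod.splits)
    show ?thesis (is "infinite ?C \<longleftrightarrow> ?R")
    proof
      assume inf: "infinite ?C"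
      show ?R
      proof
        fix F assume "F \<in> {F. finite F \<and> F \<subseteq> V}"
        then have "\<not> ?C \<subseteq> F" using inf finite_subset by auto
        then show "\<exists>z\<in>V - F. z \<in> ?C" using sub by blast
      qed
    next
      assume ?R
      then show "infinite ?C" using sub by blast
    qed
  qed
  have "Measurable.pred (boolean_percolation V \<nu> p)
      (\<lambda>\<omega>. \<exists>x\<in>V. infinite (component_in E (wet_set V E \<omega>) x))"
    unfolding eq
    by (intro measurable_pred_countable pred_mem_component assms countable_Diff
        countable_Collect_finite_subset)
  then show ?thesis
    by (simp add: pred_def)
qed

section \<open>The bound on the critical parameter\<close>

lemma emeasure_Bex_le:
  assumes "countable I" and [measurable]: "\<And>i. i \<in> I \<Longrightarrow> Measurable.pred M (P i)"
  shows "emeasure M {\<omega> \<in> space M. \<exists>i\<in>I. P i \<omega>} \<le>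
    (\<integral>\<^sup>+ i. emeasure M {\<omega> \<in> space M. P i \<omega>} \<partial>count_space I)"
proof -
  let ?P = "\<lambda>i. {\<omega> \<in> space M. P i \<omega>}"
  have [measurable]: "{\<omega> \<in> space M. \<exists>i\<in>I. P i \<omega>} \<in> sets M"
    using measurable_pred_countable(2)[OF assms] by (simp add: pred_def)
  have "emeasure M {\<omega> \<in> space M. \<exists>i\<in>I. P i \<omega>} =
      (\<integral>\<^sup>+ \<omega>. indicator {\<omega> \<in> space M. \<exists>i\<in>I. P i \<omega>} \<omega> \<partial>M)"
    by simp
  also have "\<dots> \<le> (\<integral>\<^sup>+ \<omega>. \<integral>\<^sup>+ i. indicator (?P i) \<omega> \<partial>count_space I \<partial>M)"
  proof (rule nn_integral_mono)
    fix \<omega>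
    show "indicator {\<omega> \<in> space M. \<exists>i\<in>I. P i \<omega>} \<omega> \<le>
        (\<integral>\<^sup>+ i. indicator (?P i) \<omega> \<partial>count_space I :: ennreal)"
    proof (cases "\<exists>i\<in>I. \<omega> \<in> ?P i")
      case True
      then obtain i where "i \<in> I" "\<omega> \<in> ?P i" by blast
      then have "(1 :: ennreal) \<le> (\<integral>\<^sup>+ i. indicator (?P i) \<omega> \<partial>count_space I)"
        using nn_integral_ge_point[of i I "\<lambda>i. indicator (?P i) \<omega>"] by simp
      then show ?thesis
        by (auto simp: indicator_def)
    qed (auto simp: indicator_def)
  qed
  also have "\<dots> = (\<integral>\<^sup>+ i. \<integral>\<^sup>+ \<omega>. indicator (?P i) \<omega> \<partial>M \<partial>count_space I)"
    using assms(1) by (rule nn_integral_count_space_nn_integral) measurable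
  also have "\<dots> = (\<integral>\<^sup>+ i. emeasure M (?P i) \<partial>count_space I)"
    by (intro nn_integral_cong) simp
  finally show ?thesis .
qed

text \<open>The count behind one step of a chain: for a fixed radius \<open>r\<close>, the triples \<open>(y, u, w)\<close> such
  that the ball of \<open>y\<close> contains \<open>v\<close> and \<open>u\<close>, and \<open>w\<close> is a neighbour of \<open>u\<close>.\<close>

lemma ecard_links_le_phi:
  assumes "v \<in> V" and "1 \<le> r"
  shows "ecard (SIGMA y:in_ball V E r v. Sigma (out_ball V E r y) (neighbours V E)) \<le> phi V E r"
proof -
  have "ecard (SIGMA y:in_ball V E r v. Sigma (out_ball V E r y) (neighbours V E)) \<le>
      (max_degree V E * max_out_ball V E r) * max_in_ball V E r"
  proof (intro ecard_Sigma_le)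
    show "ecard (in_ball V E r v) \<le> max_in_ball V E r"
      unfolding max_in_ball_def using assms(1) by (rule SUP_upper)
    show "ecard (out_ball V E r y) \<le> max_out_ball V E r" if "y \<in> in_ball V E r v" for y
      unfolding max_out_ball_def using that by (intro SUP_upper) (auto simp: in_ball_def)
    show "ecard (neighbours V E u) \<le> max_degree V E" if "u \<in> out_ball V E r y" for u y
      using that by (intro ecard_neighbours_le) (auto simp: out_ball_def)
  qed
  also have "\<dots> \<le> phi V E r"
    unfolding phi_def mult.assoc using assms(2)
    by (intro mult_left_mono member_le_sum) auto
  finally show ?thesis .
qed

text \<open>Union bound over the triples \<open>(y, u, w)\<close> that begin the chain. The rest of the chain avoids
  \<open>y\<close>, so it is independent of the radius and mark at \<open>y\<close> and by induction it has probability at most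
  the \<open>n\<close>-th power of the bound for a single step. What remains is the sum over the triples of the
  probability that \<open>y\<close> is open and that its radius fits; exchanging sum and expectation bounds it by \<open>p\<close> times the expectation
  of \<^const>\<open>phi\<close>.\<close>

lemma emeasure_cover_chain_le:
  assumes "countable V" and "set_pmf \<nu> \<subseteq> {1..}" and "p \<in> {0..1}" and "v \<in> V"
  shows "emeasure (boolean_percolation V \<nu> p)
      {\<omega> \<in> space (boolean_percolation V \<nu> p). cover_chain V E n S v \<omega>} \<le>
    (ennreal p * (\<integral>\<^sup>+ r. phi V E r \<partial>measure_pmf \<nu>)) ^ n"
  using assms(4)
proof (induction n arbitrary: S v)
  case 0
  interpret prob_space "boolean_percolation V \<nu> p"
    by (rule prob_space_boolean_percolation)
  show ?case by (simp add: emeasure_space_1)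
next
  case (Suc n)
  let ?M = "boolean_percolation V \<nu> p"
  define t where "t = ennreal p * (\<integral>\<^sup>+ r. phi V E r \<partial>measure_pmf \<nu>)"
  define I where "I = (V - S) \<times> Sigma V (neighbours V E)"
  define T where "T r = (SIGMA y:in_ball V E r v. Sigma (out_ball V E r y) (neighbours V E))" for r
  define P where "P = (\<lambda>(y, u, w) \<omega>. snd \<omega> y \<and> (y, u, w) \<in> T (fst \<omega> y) \<and>
    cover_chain V E n (insert y S) w \<omega>)"
  have "countable (neighbours V E u)" for u
    using assms(1) by (auto simp: neighbours_def)
  then have I: "countable I"
    unfolding I_def using assms(1) by (intro countable_SIGMA) auto
  have IH: "emeasure ?M {\<omega> \<in> space ?M. cover_chain V E n S' w \<omega>} \<le> t ^ n" if "w \<in> V" for S' w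
    unfolding t_def using Suc.IH that .
  have pred_P: "Measurable.pred ?M (P i)" if "i \<in> I" for i
  proof -
    obtain y u w where i: "i = (y, u, w)" by (cases i)
    then have "y \<in> V" using that by (simp add: I_def)
    show ?thesis
      unfolding i P_def prod.case
      by (intro pred_intros_logic pred_cover_chain assms(1) measurable_mark \<open>y \<in> V\<close>
          measurable_compose[OF measurable_radius[OF \<open>y \<in> V\<close>]]) simp
  qed
  have P_le: "emeasure ?M {\<omega> \<in> space ?M. P i \<omega>} \<le>
      (\<integral>\<^sup>+ r. indicator (T r) i \<partial>measure_pmf \<nu>) * (ennreal p * t ^ n)" if "i \<in> I" for i
  proof -
    obtain y u w where i: "i = (y, u, w)" by (cases i)
    then have "y \<in> V" "w \<in> V" using that by (auto simp: I_def neighbours_def)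
    let ?C = "{\<omega>. cover_chain V E n (insert y S) w \<omega>}"
    have [measurable]: "Measurable.pred ?M (cover_chain V E n (insert y S) w)"
      by (rule pred_cover_chain[OF assms(1)])
    have C: "indicator ?C \<in> borel_measurable ?M"
      by measurable
    have [measurable]: "{\<omega> \<in> space ?M. P i \<omega>} \<in> sets ?M"
      using pred_P[OF that] by (simp add: pred_def)
    have "emeasure ?M {\<omega> \<in> space ?M. P i \<omega>} = (\<integral>\<^sup>+ \<omega>. indicator {\<omega> \<in> space ?M. P i \<omega>} \<omega> \<partial>?M)"
      by simp
    also have "\<dots> = (\<integral>\<^sup>+ \<omega>. indicator (T (fst \<omega> y)) i * indicator {True} (snd \<omega> y) *
        indicator ?C \<omega> \<partial>?M)"
      by (intro nn_integral_cong) (auto simp: P_def i indicator_def)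
    also have "\<dots> = (\<integral>\<^sup>+ r. indicator (T r) i \<partial>measure_pmf \<nu>) *
        (\<integral>\<^sup>+ b. indicator {True} b \<partial>measure_pmf (bernoulli_pmf p)) *
        (\<integral>\<^sup>+ \<omega>. indicator ?C \<omega> \<partial>?M)"
      by (rule nn_integral_boolean_percolation_component_mult
            [where g = "\<lambda>r. indicator (T r) i" and h = "indicator {True}", OF \<open>y \<in> V\<close> C])
        (simp add: indicator_def cover_chain_upd)
    also have "(\<integral>\<^sup>+ b. indicator {True} b \<partial>measure_pmf (bernoulli_pmf p)) = ennreal p"
      using assms(3) by (simp add: emeasure_pmf_single)
    also have "(\<integral>\<^sup>+ \<omega>. indicator ?C \<omega> \<partial>?M) =
        (\<integral>\<^sup>+ \<omega>. indicator {\<omega> \<in> space ?M. cover_chain V E n (insert y S) w \<omega>} \<omega> \<partial>?M)"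
      by (intro nn_integral_cong) (simp add: indicator_def)
    also have "\<dots> = emeasure ?M {\<omega> \<in> space ?M. cover_chain V E n (insert y S) w \<omega>}"
      by simp
    also have "(\<integral>\<^sup>+ r. indicator (T r) i \<partial>measure_pmf \<nu>) * ennreal p * \<dots> \<le>
        (\<integral>\<^sup>+ r. indicator (T r) i \<partial>measure_pmf \<nu>) * ennreal p * t ^ n"
      using IH[OF \<open>w \<in> V\<close>] by (rule mult_left_mono) simp
    finally show ?thesis by (simp add: mult.assoc)
  qed
  have T_le: "(\<integral>\<^sup>+ i. indicator (T r) i \<partial>count_space I) \<le> phi V E r" if "r \<in> set_pmf \<nu>" for r
  proof -
    have "(\<integral>\<^sup>+ i. indicator (T r) i \<partial>count_space I) =
        (\<integral>\<^sup>+ i. indicator (T r) i * indicator I i \<partial>count_space UNIV)"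
      by (rule nn_integral_count_space_indicator) simp
    also have "\<dots> \<le> (\<integral>\<^sup>+ i. indicator (T r) i \<partial>count_space UNIV)"
      by (rule nn_integral_mono) (simp add: indicator_def)
    also have "\<dots> = ecard (T r)"
      by (simp add: ecard_eq_emeasure)
    also have "\<dots> \<le> phi V E r"
      unfolding T_def using Suc.prems that assms(2) by (intro ecard_links_le_phi) auto
    finally show ?thesis .
  qed
  have "\<exists>i\<in>I. P i \<omega>" if chain: "cover_chain V E (Suc n) S v \<omega>" for \<omega>
  proof -
    obtain y u w where y: "y \<in> V - S" "snd \<omega> y" "v \<in> out_ball V E (fst \<omega> y) y"
      and u: "u \<in> out_ball V E (fst \<omega> y) y" "w \<in> neighbours V E u"
      and w: "cover_chain V E n (insert y S) w \<omega>"
      using chain by auto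
    have "y \<in> in_ball V E (fst \<omega> y) v"
      using y by (auto simp: mem_in_ball_iff mem_out_ball_iff)
    moreover have "u \<in> V"
      using u(1) by (simp add: out_ball_def)
    ultimately have "(y, u, w) \<in> I" "P (y, u, w) \<omega>"
      using y u w by (auto simp: I_def P_def T_def)
    then show ?thesis by blast
  qed
  then have "emeasure ?M {\<omega> \<in> space ?M. cover_chain V E (Suc n) S v \<omega>} \<le>
      emeasure ?M {\<omega> \<in> space ?M. \<exists>i\<in>I. P i \<omega>}"
    using measurable_pred_countable(2)[OF I pred_P]
    by (intro emeasure_mono) (auto simp: pred_def simp del: cover_chain.simps)
  also have "\<dots> \<le> (\<integral>\<^sup>+ i. emeasure ?M {\<omega> \<in> space ?M. P i \<omega>} \<partial>count_space I)"
    by (rule emeasure_Bex_le[OF I pred_P])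
  also have "\<dots> \<le> (\<integral>\<^sup>+ i. (\<integral>\<^sup>+ r. indicator (T r) i \<partial>measure_pmf \<nu>) * (ennreal p * t ^ n) \<partial>count_space I)"
    by (intro nn_integral_mono P_le) simp
  also have "\<dots> = (\<integral>\<^sup>+ i. (\<integral>\<^sup>+ r. indicator (T r) i \<partial>measure_pmf \<nu>) \<partial>count_space I) * (ennreal p * t ^ n)"
    by (rule nn_integral_multc) simp
  also have "(\<integral>\<^sup>+ i. (\<integral>\<^sup>+ r. indicator (T r) i \<partial>measure_pmf \<nu>) \<partial>count_space I) =
      (\<integral>\<^sup>+ r. (\<integral>\<^sup>+ i. indicator (T r) i \<partial>count_space I) \<partial>measure_pmf \<nu>)"
    using I by (rule nn_integral_count_space_nn_integral[symmetric]) simp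
  also have "\<dots> \<le> (\<integral>\<^sup>+ r. phi V E r \<partial>measure_pmf \<nu>)"
    by (intro nn_integral_mono_AE) (simp add: AE_measure_pmf_iff T_le)
  finally have "emeasure ?M {\<omega> \<in> space ?M. cover_chain V E (Suc n) S v \<omega>} \<le>
      (\<integral>\<^sup>+ r. phi V E r \<partial>measure_pmf \<nu>) * (ennreal p * t ^ n)"
    by (simp add: mult_right_mono)
  then show ?case
    by (simp add: t_def mult_ac)
qed

lemma percolation_prob_subcritical:
  assumes "E \<subseteq> V \<times> V" and "weakly_connected V E" and "max_degree V E < \<infinity>"
    and "set_pmf \<nu> \<subseteq> {1..}" and "p \<in> {0..1}"
    and "ennreal p * (\<integral>\<^sup>+ r. phi V E r \<partial>measure_pmf \<nu>) < 1"
  shows "percolation_prob V E \<nu> p = 0"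
proof -
  let ?M = "boolean_percolation V \<nu> p"
  define t where "t = ennreal p * (\<integral>\<^sup>+ r. phi V E r \<partial>measure_pmf \<nu>)"
  have V: "countable V"
    by (rule countable_vertices[OF assms(1-3)])
  have chain_sets: "{\<omega> \<in> space ?M. cover_chain V E n {} x \<omega>} \<in> sets ?M" for n x
    using pred_cover_chain[OF V] by (simp add: pred_def)
  have null: "{\<omega> \<in> space ?M. \<forall>n. cover_chain V E n {} x \<omega>} \<in> null_sets ?M" if "x \<in> V" for x
  proof (rule null_setsI)
    obtain c where c: "t = ennreal c" "0 \<le> c" "c < 1"
      using assms(6) unfolding t_def[symmetric] by (cases t) (auto simp: ennreal_less_one_iff)
    have "emeasure ?M {\<omega> \<in> space ?M. \<forall>n. cover_chain V E n {} x \<omega>} \<le> ennreal (c ^ n)" for n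
    proof -
      have "emeasure ?M {\<omega> \<in> space ?M. \<forall>n. cover_chain V E n {} x \<omega>} \<le>
          emeasure ?M {\<omega> \<in> space ?M. cover_chain V E n {} x \<omega>}"
        by (intro emeasure_mono chain_sets) blast
      also have "\<dots> \<le> t ^ n"
        unfolding t_def by (rule emeasure_cover_chain_le[OF V assms(4,5) that])
      finally show ?thesis using c by (simp add: ennreal_power)
    qed
    moreover have "(\<lambda>n. ennreal (c ^ n)) \<longlonglongrightarrow> ennreal 0"
      using c by (intro tendsto_ennrealI LIMSEQ_realpow_zero)
    ultimately have "emeasure ?M {\<omega> \<in> space ?M. \<forall>n. cover_chain V E n {} x \<omega>} \<le> ennreal 0"
      by (intro LIMSEQ_le_const) auto
    then show "emeasure ?M {\<omega> \<in> space ?M. \<forall>n. cover_chain V E n {} x \<omega>} = 0"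
      by simp
    show "{\<omega> \<in> space ?M. \<forall>n. cover_chain V E n {} x \<omega>} \<in> sets ?M"
      using chain_sets by (rule sets.sets_Collect_countable_All)
  qed
  let ?N = "\<Union>x\<in>V. {\<omega> \<in> space ?M. \<forall>n. cover_chain V E n {} x \<omega>}"
  have N: "?N \<in> null_sets ?M"
    using V null by (rule null_sets_UN')
  have "{\<omega> \<in> space ?M. \<exists>x\<in>V. infinite (component_in E (wet_set V E \<omega>) x)} \<subseteq> ?N"
    using infinite_component_imp_cover_chain[OF assms(1,3) order.refl, of "{}"] by blast
  then have "emeasure ?M {\<omega> \<in> space ?M. \<exists>x\<in>V. infinite (component_in E (wet_set V E \<omega>) x)} = 0"
    using emeasure_mono[of _ ?N ?M] N by (metis (lifting) le_zero_eq null_setsD1 null_setsD2)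
  then show ?thesis
    by (simp add: percolation_prob_def measure_def)
qed

text \<open>All marks are \<open>1\<close> and all radii positive almost surely, so every vertex covers itself.\<close>

lemma percolation_prob_one:
  assumes "E \<subseteq> V \<times> V" and "infinite V" and "weakly_connected V E" and "max_degree V E < \<infinity>"
    and "set_pmf \<nu> \<subseteq> {1..}"
  shows "percolation_prob V E \<nu> 1 = 1"
proof -
  let ?M = "boolean_percolation V \<nu> 1"
  let ?A = "\<Pi>\<^sub>M x\<in>V. measure_pmf \<nu>" and ?B = "\<Pi>\<^sub>M x\<in>V. measure_pmf (bernoulli_pmf 1)"
  interpret prob_space ?M by (rule prob_space_boolean_percolation)
  interpret A: prob_space ?A by (rule prob_space_PiM) (rule measure_pmf.prob_space_axioms)
  interpret B: prob_space ?B by (rule prob_space_PiM) (rule measure_pmf.prob_space_axioms)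
  interpret AB: pair_sigma_finite ?A ?B ..
  have V: "countable V"
    by (rule countable_vertices[OF assms(1,3,4)])
  have mark: "b" if "b \<in> set_pmf (bernoulli_pmf 1)" for b
    using that by (cases b) (auto simp: set_pmf_iff)
  have AE_mark: "AE \<sigma> in ?B. \<forall>x\<in>V. \<sigma> x"
    by (intro AE_ball_countable[THEN iffD2] V ballI AE_PiM_component)
      (auto simp: AE_measure_pmf_iff measure_pmf.prob_space_axioms dest: mark)
  have "AE R in ?A. \<forall>x\<in>V. 1 \<le> R x"
    using assms(5) by (intro AE_ball_countable[THEN iffD2] V ballI AE_PiM_component)
      (auto simp: AE_measure_pmf_iff measure_pmf.prob_space_axioms)
  then have "AE R in ?A. AE \<sigma> in ?B. \<forall>x\<in>V. 1 \<le> R x \<and> \<sigma> x"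
    by (elim eventually_mono) (use AE_mark in \<open>auto elim!: eventually_mono\<close>)
  moreover have "{\<omega> \<in> space ?M. \<forall>x\<in>V. 1 \<le> fst \<omega> x \<and> snd \<omega> x} \<in> sets ?M"
  proof -
    have "Measurable.pred ?M (\<lambda>\<omega>. \<forall>x\<in>V. 1 \<le> fst \<omega> x \<and> snd \<omega> x)"
      by (intro measurable_pred_countable V pred_intros_logic measurable_mark
          measurable_compose[OF measurable_radius]) auto
    then show ?thesis by (simp add: pred_def)
  qed
  ultimately have "AE \<omega> in ?M. \<forall>x\<in>V. 1 \<le> fst \<omega> x \<and> snd \<omega> x"
    unfolding boolean_percolation_def
    by (intro AB.AE_pair_measure) auto
  moreover obtain x where x: "x \<in> V"
    using infinite_imp_nonempty[OF assms(2)] by blast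
  have "infinite (component_in E (wet_set V E \<omega>) x)"
    if \<omega>: "\<forall>x\<in>V. 1 \<le> fst \<omega> x \<and> snd \<omega> x" for \<omega>
  proof -
    have "y \<in> out_ball V E (fst \<omega> y) y" if "y \<in> V" for y
      using that \<omega> by (auto simp: mem_out_ball_iff intro!: exI[of _ 0])
    then have "wet_set V E \<omega> = V"
      using \<omega> by (auto simp: wet_set_def split: prod.splits) (auto simp: out_ball_def)
    moreover have "(E \<union> E\<inverse>) \<inter> V \<times> V = E \<union> E\<inverse>"
      using assms(1) by auto
    ultimately have "component_in E (wet_set V E \<omega>) x = V"
      using assms(3) x by (auto simp: component_in_def weakly_connected_def)
    then show ?thesis using assms(2) by simp
  qed
  ultimately have "AE \<omega> in ?M. \<exists>x\<in>V. infinite (component_in E (wet_set V E \<omega>) x)"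
    using x by (auto elim!: eventually_mono)
  then show ?thesis
    unfolding percolation_prob_def
    using sets_infinite_component[OF V] by (intro prob_Collect_eq_1[THEN iffD2])
qed

theorem theorem1:
  fixes V :: "'v set" and E :: "'v rel" and \<nu> :: "nat pmf"
  assumes "E \<subseteq> V \<times> V"
    and "infinite V"
    and "weakly_connected V E"
    and "max_degree V E < \<infinity>"
    and "set_pmf \<nu> \<subseteq> {1..}"
    and "(\<integral>\<^sup>+ r. phi V E r \<partial>measure_pmf \<nu>) < \<infinity>"
  shows "ennreal (critical_param V E \<nu>) \<ge> 1 / (\<integral>\<^sup>+ r. phi V E r \<partial>measure_pmf \<nu>)
       \<and> 1 / (\<integral>\<^sup>+ r. phi V E r \<partial>measure_pmf \<nu>) > 0"
proof
  define m where "m = (\<integral>\<^sup>+ r. phi V E r \<partial>measure_pmf \<nu>)"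
  define Q where "Q = {p \<in> {0..1}. percolation_prob V E \<nu> p = 1}"
  have "m < \<infinity>"
    using assms(6) by (simp add: m_def)
  then obtain c where c: "m = ennreal c" "0 \<le> c"
    by (cases m) auto
  have mult_ge: "1 \<le> p * c" if "p \<in> Q" for p
  proof (rule ccontr)
    assume "\<not> 1 \<le> p * c"
    then have "ennreal p * m < 1"
      using c that by (simp add: Q_def ennreal_mult[symmetric] ennreal_less_one_iff)
    then have "percolation_prob V E \<nu> p = 0"
      using that assms(1,3-5) unfolding m_def Q_def by (intro percolation_prob_subcritical) auto
    then show False
      using that by (simp add: Q_def)
  qed
  have "1 \<in> Q"
    using percolation_prob_one[OF assms(1-5)] by (simp add: Q_def)
  then have "0 < c"
    using mult_ge[of 1] by simp
  then have "1 / c \<le> Inf Q"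
    using \<open>1 \<in> Q\<close> mult_ge by (intro cInf_greatest) (auto simp: field_simps)
  moreover have "1 / m = ennreal (1 / c)"
    using c \<open>0 < c\<close> by (simp add: divide_ennreal flip: ennreal_1)
  ultimately show "ennreal (critical_param V E \<nu>) \<ge> 1 / (\<integral>\<^sup>+ r. phi V E r \<partial>measure_pmf \<nu>)"
    unfolding critical_param_def m_def[symmetric] Q_def[symmetric] by (simp add: ennreal_leI)
  show "1 / (\<integral>\<^sup>+ r. phi V E r \<partial>measure_pmf \<nu>) > 0"
    using \<open>1 / m = ennreal (1 / c)\<close> \<open>0 < c\<close> by (simp add: m_def)
qed

end
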